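(* Let $G$ be a connected chordal graph and let $r=r_0,\dots,r_{|r|-1}$ be a separator path in $G$. For all $0\le i<j<|r|$, the vertices $r_i$ and $r_j$ are strongly $r$-connected if and only if $j-i=2$.
   Context: A chordal graph is a simple undirected graph in which every cycle with four or more vertices has a chord. A path is a sequence of vertices with consecutive vertices adjacent; it is simple if its vertices are distinct; $p_{i,j}$ is the subpath $p_i,\dots,p_j$ and $p$ contains $q$ if $q=p_{i,j}$ for some $i\le j$. A path is separating if removing all its edges disconnects $G$. A separator path is a simple separating path not containing any separating path other than itself. For a simple path $p$, two vertices $u,v$ are strongly $p$-connected if there is a path $p'$ between $u$ and $v$ that shares no edge with $p$ and, except at its endpoints, shares no vertex with $p$. *)

theory Defs
  imports Main
begin

text \<open>
  A simple undirected graph is given by its vertex set \<open>V\<close> and its edge set \<open>E\<close>, edges being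
  two-element sets of vertices. Graphs are not required to be finite; paths and cycles are finite
  lists of vertices.
\<close>

definition simple_graph :: "'a set \<Rightarrow> 'a set set \<Rightarrow> bool" where
  "simple_graph V E \<longleftrightarrow> (\<forall>e\<in>E. \<exists>u\<in>V. \<exists>v\<in>V. u \<noteq> v \<and> e = {u, v})"

definition is_path :: "'a set \<Rightarrow> 'a set set \<Rightarrow> 'a list \<Rightarrow> bool" where
  "is_path V E p \<longleftrightarrow> p \<noteq> [] \<and> set p \<subseteq> V \<and> successively (\<lambda>u v. {u, v} \<in> E) p"

definition path_edges :: "'a list \<Rightarrow> 'a set set" where
  "path_edges p = {{p ! k, p ! Suc k} | k. Suc k < length p}"

definition subpath :: "'a list \<Rightarrow> nat \<Rightarrow> nat \<Rightarrow> 'a list" where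
  "subpath p i j = map (\<lambda>k. p ! k) [i..<Suc j]"

definition contains_path :: "'a list \<Rightarrow> 'a list \<Rightarrow> bool" where
  "contains_path p q \<longleftrightarrow> (\<exists>i j. i \<le> j \<and> j < length p \<and> q = subpath p i j)"

definition path_between :: "'a set \<Rightarrow> 'a set set \<Rightarrow> 'a \<Rightarrow> 'a list \<Rightarrow> 'a \<Rightarrow> bool" where
  "path_between V E u p v \<longleftrightarrow> is_path V E p \<and> hd p = u \<and> last p = v"

definition connected_graph :: "'a set \<Rightarrow> 'a set set \<Rightarrow> bool" where
  "connected_graph V E \<longleftrightarrow> (\<forall>u\<in>V. \<forall>v\<in>V. \<exists>p. path_between V E u p v)"

definition is_cycle :: "'a set \<Rightarrow> 'a set set \<Rightarrow> 'a list \<Rightarrow> bool" where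
  "is_cycle V E c \<longleftrightarrow> is_path V E c \<and> distinct c \<and> 3 \<le> length c \<and> {last c, hd c} \<in> E"

definition cycle_edges :: "'a list \<Rightarrow> 'a set set" where
  "cycle_edges c = insert {last c, hd c} (path_edges c)"

definition is_chord :: "'a set set \<Rightarrow> 'a list \<Rightarrow> 'a set \<Rightarrow> bool" where
  "is_chord E c e \<longleftrightarrow> e \<in> E \<and> e \<subseteq> set c \<and> e \<notin> cycle_edges c"

definition chordal_graph :: "'a set \<Rightarrow> 'a set set \<Rightarrow> bool" where
  "chordal_graph V E \<longleftrightarrow>
    simple_graph V E \<and> (\<forall>c. is_cycle V E c \<and> 4 \<le> length c \<longrightarrow> (\<exists>e. is_chord E c e))"

text \<open>Removing the edges of a path keeps all vertices of the graph.\<close>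

definition separating_path :: "'a set \<Rightarrow> 'a set set \<Rightarrow> 'a list \<Rightarrow> bool" where
  "separating_path V E p \<longleftrightarrow> is_path V E p \<and> \<not> connected_graph V (E - path_edges p)"

definition separator_path :: "'a set \<Rightarrow> 'a set set \<Rightarrow> 'a list \<Rightarrow> bool" where
  "separator_path V E p \<longleftrightarrow>
    distinct p \<and> separating_path V E p \<and>
    (\<forall>q. contains_path p q \<and> separating_path V E q \<longrightarrow> q = p)"

definition strongly_connected ::
  "'a set \<Rightarrow> 'a set set \<Rightarrow> 'a list \<Rightarrow> 'a \<Rightarrow> 'a \<Rightarrow> bool" where
  "strongly_connected V E p u v \<longleftrightarrow>
    (\<exists>p'. path_between V E u p' v \<and> path_edges p' \<inter> path_edges p = {} \<and>
          set p' \<inter> set p \<subseteq> {u, v})"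

end

theory Submission
  imports Defs
begin

text \<open>
  By minimality of \<open>r\<close>, the graph without the edges of \<open>r\<close> has exactly two components \<open>A\<close> and \<open>B\<close>,
  and every edge of \<open>G\<close> between them lies on \<open>r\<close>. If two disjoint connected vertex sets of a chordal
  graph are joined by edges both inside and outside a set \<open>F\<close>, then a shortest cycle using one
  joining edge of each kind is a triangle. With \<open>F\<close> the first \<open>k + 1\<close> edges of \<open>r\<close>, that
  triangle between \<open>A\<close> and \<open>B\<close> can only be \<open>r\<^sub>k, r\<^sub>k\<^sub>+\<^sub>1, r\<^sub>k\<^sub>+\<^sub>2\<close>. So the vertices of \<open>r\<close>
  alternate between the two components, and vertices at distance two along \<open>r\<close> are adjacent.

  Conversely, if \<open>r\<^sub>i\<close> and \<open>r\<^sub>j\<close> are joined by a path \<open>p\<close> as in the definition, then \<open>j - i\<close> is even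
  and \<open>p\<close> lies in one component. The vertices \<open>r\<^sub>i\<^sub>+\<^sub>1, r\<^sub>i\<^sub>+\<^sub>3, \<dots>, r\<^sub>j\<^sub>-\<^sub>1\<close> form a connected set in the
  other one, joined to \<open>p\<close> only by the first and last edges of \<open>r\<close> between \<open>r\<^sub>i\<close> and \<open>r\<^sub>j\<close>. For
  \<open>j - i \<ge> 4\<close> these two edges share no vertex, contradicting the existence of a triangle containing
  both.
\<close>

section \<open>Reachability inside a vertex set, and components\<close>

text \<open>Walks must stay inside \<open>X\<close>, so the full edge set \<open>E\<close> can be
  kept when \<open>X\<close> is a component or the vertex set of a path. The closure is reflexive on
  the whole type, also outside \<open>X\<close>; hence the membership hypothesis in
  \<open>reach_closed\<close>.\<close>

definition reach :: "'a set \<Rightarrow> 'a set set \<Rightarrow> ('a \<times> 'a) set" where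
  "reach X E = {(a, b). a \<in> X \<and> b \<in> X \<and> {a, b} \<in> E}\<^sup>*"

lemma reach_refl [simp]: "(a, a) \<in> reach X E"
  by (simp add: reach_def)

lemma reach_edge: "a \<in> X \<Longrightarrow> b \<in> X \<Longrightarrow> {a, b} \<in> E \<Longrightarrow> (a, b) \<in> reach X E"
  by (auto simp: reach_def)

lemma reach_trans: "(a, b) \<in> reach X E \<Longrightarrow> (b, c) \<in> reach X E \<Longrightarrow> (a, c) \<in> reach X E"
  unfolding reach_def by (rule rtrancl_trans)

lemma reach_sym: "(a, b) \<in> reach X E \<Longrightarrow> (b, a) \<in> reach X E"
  unfolding reach_def by (rule symD[OF sym_rtrancl]) (auto simp: sym_def insert_commute)

lemma reach_closed: "(a, b) \<in> reach X E \<Longrightarrow> a \<in> X \<Longrightarrow> b \<in> X"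
  unfolding reach_def by (induction rule: rtrancl_induct) auto

lemma reach_induct [consumes 1, case_names refl step]:
  assumes "(a, b) \<in> reach X E" and "P a"
    and "\<And>y z. (a, y) \<in> reach X E \<Longrightarrow> y \<in> X \<Longrightarrow> z \<in> X \<Longrightarrow> {y, z} \<in> E \<Longrightarrow> P y \<Longrightarrow> P z"
  shows "P b"
  using assms(1) unfolding reach_def
proof (induction rule: rtrancl_induct)
  case base
  show ?case by (fact assms(2))
next
  case (step y z)
  then show ?case using assms(3)[of y z] by (auto simp: reach_def)
qed

lemma path_reach:
  assumes "is_path X E p" and "x \<in> set p"
  shows "(hd p, x) \<in> reach X E"
  using assms
proof (induction p)
  case Nil
  then show ?case by simp
next
  case (Cons a p)
  show ?case
  proof (cases "x = a \<or> p = []")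
    case True
    then show ?thesis using Cons.prems by auto
  next
    case False
    then have "is_path X E p" "x \<in> set p" "a \<in> X" "hd p \<in> X" "{a, hd p} \<in> E"
      using Cons.prems by (auto simp: is_path_def successively_Cons)
    then show ?thesis
      using Cons.IH reach_edge[of a X "hd p" E] by (auto intro: reach_trans)
  qed
qed

lemma connected_graph_reach:
  "connected_graph X E \<longleftrightarrow> (\<forall>u\<in>X. \<forall>v\<in>X. (u, v) \<in> reach X E)"
proof (intro iffI ballI)
  fix u v
  assume "connected_graph X E" "u \<in> X" "v \<in> X"
  then obtain p where "path_between X E u p v" by (auto simp: connected_graph_def)
  then show "(u, v) \<in> reach X E"
    using path_reach[of X E p v] by (auto simp: path_between_def is_path_def)
next
  assume *: "\<forall>u\<in>X. \<forall>v\<in>X. (u, v) \<in> reach X E"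
  have "\<exists>p. path_between X E u p v" if "(u, v) \<in> reach X E" "u \<in> X" for u v
    using that(1)
  proof (induction rule: reach_induct)
    case refl
    have "path_between X E u [u] u" using that(2) by (simp add: path_between_def is_path_def)
    then show ?case by blast
  next
    case (step y z)
    then obtain p where "path_between X E u p y" by blast
    then have "path_between X E u (p @ [z]) z"
      using step by (auto simp: path_between_def is_path_def successively_append_iff)
    then show ?case by blast
  qed
  then show "connected_graph X E" using * by (auto simp: connected_graph_def)
qed

lemma connected_graph_root:
  assumes "\<And>v. v \<in> X \<Longrightarrow> (a, v) \<in> reach X E"
  shows "connected_graph X E"
  unfolding connected_graph_reach using assms by (blast intro: reach_trans reach_sym)

text \<open>Every vertex on a walk from \<open>a\<close> is itself in the component, so the walk
  never leaves \<open>X\<close>. This makes components of the smaller graph \<open>D\<close> usable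
  as connected sets in the original graph.\<close>

lemma connected_graph_component:
  assumes "D \<subseteq> E" and "X = {v. (a, v) \<in> reach V D}"
  shows "connected_graph X E"
proof (rule connected_graph_root)
  fix v assume "v \<in> X"
  then have "(a, v) \<in> reach V D" using assms(2) by simp
  then show "(a, v) \<in> reach X E"
  proof (induction rule: reach_induct)
    case refl
    show ?case by simp
  next
    case (step y z)
    then have "(a, z) \<in> reach V D" by (blast intro: reach_trans reach_edge)
    with step have "(y, z) \<in> reach X E" using assms by (intro reach_edge) auto
    with step show ?case by (blast intro: reach_trans)
  qed
qed

lemma connected_graph_path:
  assumes "is_path X E p"
  shows "connected_graph (set p) E"
proof -
  have "is_path (set p) E p" using assms by (simp add: is_path_def)
  then show ?thesis by (intro connected_graph_root) (rule path_reach)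
qed

text \<open>Each use of the extra edge in a walk lands on \<open>a\<close> or \<open>b\<close>, so
  every vertex is reachable in \<open>D\<close> from one of them. If \<open>a\<close> and
  \<open>b\<close> were themselves linked in \<open>D\<close>, then \<open>D\<close> would be
  connected.\<close>

lemma two_components:
  assumes "connected_graph V D'" and "D' \<subseteq> insert {a, b} D" and "\<not> connected_graph V D"
    and "a \<in> V" "b \<in> V" and "v \<in> V"
  shows "(a, v) \<in> reach V D \<longleftrightarrow> (b, v) \<notin> reach V D"
proof -
  have ex: "(a, w) \<in> reach V D \<or> (b, w) \<in> reach V D" if "w \<in> V" for w
  proof -
    have "(a, w) \<in> reach V D'" using assms that by (simp add: connected_graph_reach)
    then show ?thesis
    proof (induction rule: reach_induct)
      case refl
      show ?case by simp
    next
      case (step y z)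
      show ?case
      proof (cases "{y, z} \<in> D")
        case True
        then have "(y, z) \<in> reach V D" using step by (intro reach_edge)
        then show ?thesis using step by (blast intro: reach_trans)
      next
        case False
        then have "z \<in> {a, b}" using step(4) assms(2) by blast
        then show ?thesis by auto
      qed
    qed
  qed
  have "(a, b) \<notin> reach V D"
  proof
    assume "(a, b) \<in> reach V D"
    then have "connected_graph V D" using ex by (intro connected_graph_root) (blast intro: reach_trans)
    with assms(3) show False ..
  qed
  then show ?thesis using ex[OF assms(6)] by (blast intro: reach_trans reach_sym)
qed

section \<open>Cutting, shortening and joining paths\<close>

lemma is_path_take: "is_path X E p \<Longrightarrow> is_path X E (take (Suc a) p)"
  unfolding is_path_def
  by (metis append_take_drop_id set_take_subset subset_trans successively_append_iff take_eq_Nil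
      nat.distinct(1))

lemma is_path_drop: "is_path X E p \<Longrightarrow> a < length p \<Longrightarrow> is_path X E (drop a p)"
  unfolding is_path_def
  by (metis append_take_drop_id set_drop_subset subset_trans successively_append_iff drop_eq_Nil
      linorder_not_le)

lemma is_path_append:
  "is_path X E p \<Longrightarrow> is_path X E q \<Longrightarrow> {last p, hd q} \<in> E \<Longrightarrow> is_path X E (p @ q)"
  by (auto simp: is_path_def successively_append_iff)

lemma last_take_Suc: "a < length p \<Longrightarrow> last (take (Suc a) p) = p ! a"
  by (simp add: take_Suc_conv_app_nth)

lemma path_shortcut:
  assumes p: "is_path X E p" and ab: "a < b" "b < length p"
    and short: "p ! a = p ! b \<or> {p ! a, p ! b} \<in> E \<and> Suc a < b"
  shows "\<exists>p'. is_path X E p' \<and> hd p' = hd p \<and> last p' = last p \<and> length p' < length p"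
  using short
proof
  assume eq: "p ! a = p ! b"
  show ?thesis
  proof (cases a)
    case 0
    have "hd (drop b p) = hd p" using eq 0 ab p by (simp add: hd_drop_conv_nth hd_conv_nth is_path_def)
    then show ?thesis using is_path_drop[OF p ab(2)] ab by (intro exI[of _ "drop b p"]) auto
  next
    \<comment> \<open>Index \<open>c\<close> is the last one before \<open>a\<close>; as
      \<open>p ! a = p ! b\<close>, the edge leaving \<open>p ! c\<close> leads directly to the
      start of \<open>drop b p\<close>. For \<open>a = 0\<close> there is no such prefix.\<close>
    case (Suc c)
    have "successively (\<lambda>u v. {u, v} \<in> E) p" using p by (simp add: is_path_def)
    then have "{p ! c, p ! Suc c} \<in> E" using ab Suc by (simp add: successively_conv_nth)
    then have "is_path X E (take (Suc c) p @ drop b p)"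
      using eq ab Suc p by (intro is_path_append is_path_take is_path_drop)
        (auto simp: last_take_Suc hd_drop_conv_nth)
    then show ?thesis using ab Suc p
      by (intro exI[of _ "take (Suc c) p @ drop b p"]) (auto simp: is_path_def)
  qed
next
  assume e: "{p ! a, p ! b} \<in> E \<and> Suc a < b"
  then have "is_path X E (take (Suc a) p @ drop b p)"
    using ab p by (intro is_path_append is_path_take is_path_drop)
      (auto simp: last_take_Suc hd_drop_conv_nth)
  then show ?thesis using ab e p
    by (intro exI[of _ "take (Suc a) p @ drop b p"]) (auto simp: is_path_def)
qed

lemma path_edges_append:
  assumes "p \<noteq> []" "q \<noteq> []"
  shows "path_edges (p @ q) = path_edges p \<union> {{last p, hd q}} \<union> path_edges q"
proof (intro equalityI subsetI)
  fix e assume "e \<in> path_edges (p @ q)"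
  then obtain k where k: "Suc k < length p + length q" "e = {(p @ q) ! k, (p @ q) ! Suc k}"
    by (auto simp: path_edges_def)
  consider "Suc k < length p" | "Suc k = length p" | "length p \<le> k" by linarith
  then show "e \<in> path_edges p \<union> {{last p, hd q}} \<union> path_edges q"
  proof cases
    case 1
    then show ?thesis using k by (auto simp: path_edges_def nth_append)
  next
    case 2
    then have "k = length p - 1" by simp
    then show ?thesis using k 2 assms by (simp add: nth_append last_conv_nth hd_conv_nth)
  next
    case 3
    then have "e = {q ! (k - length p), q ! Suc (k - length p)}" "Suc (k - length p) < length q"
      using k by (auto simp: nth_append Suc_diff_le)
    then show ?thesis by (auto simp: path_edges_def)
  qed
next
  fix e assume "e \<in> path_edges p \<union> {{last p, hd q}} \<union> path_edges q"
  then consider (1) k where "e = {p ! k, p ! Suc k}" "Suc k < length p" | (2) "e = {last p, hd q}"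
    | (3) k where "e = {q ! k, q ! Suc k}" "Suc k < length q"
    by (auto simp: path_edges_def)
  then have "\<exists>k. Suc k < length (p @ q) \<and> e = {(p @ q) ! k, (p @ q) ! Suc k}"
  proof cases
    case (1 k)
    then show ?thesis by (intro exI[of _ k]) (auto simp: nth_append)
  next
    case 2
    then show ?thesis using assms
      by (intro exI[of _ "length p - 1"]) (auto simp: nth_append last_conv_nth hd_conv_nth)
  next
    case (3 k)
    then show ?thesis by (intro exI[of _ "length p + k"]) (auto simp: nth_append)
  qed
  then show "e \<in> path_edges (p @ q)" by (auto simp: path_edges_def)
qed

lemma nonadjacent_indices:
  assumes "u \<in> set p" "v \<in> set p" "u \<noteq> v" "{u, v} \<notin> path_edges p"
  obtains a b where "Suc a < b" "b < length p" "{u, v} = {p ! a, p ! b}"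
proof -
  obtain a b where ab: "a < length p" "b < length p" "u = p ! a" "v = p ! b"
    using assms by (metis in_set_conv_nth)
  have "a \<noteq> b" "Suc a \<noteq> b" "Suc b \<noteq> a"
    using ab assms by (auto simp: path_edges_def insert_commute)
  then have "Suc a < b \<or> Suc b < a" by linarith
  then show ?thesis using that[of a b] that[of b a] ab by (auto simp: insert_commute)
qed

section \<open>Triangles crossing between two connected sets\<close>

lemma crossing_triangle:
  assumes chordal: "chordal_graph V E" and XY: "X \<subseteq> V" "Y \<subseteq> V" "X \<inter> Y = {}"
    and conn: "connected_graph X E" "connected_graph Y E"
    and e1: "x1 \<in> X" "y1 \<in> Y" "{x1, y1} \<in> E" "{x1, y1} \<in> F"
    and e2: "x2 \<in> X" "y2 \<in> Y" "{x2, y2} \<in> E" "{x2, y2} \<notin> F"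
  obtains x y y' where "{x, y} \<in> E" "{x, y} \<in> F" "{x, y'} \<in> E" "{x, y'} \<notin> F" "{y, y'} \<in> E"
    "x \<in> X \<and> y \<in> Y \<and> y' \<in> Y \<or> x \<in> Y \<and> y \<in> X \<and> y' \<in> X"
proof -
  \<comment> \<open>The cycle \<open>p @ q\<close> crosses between \<open>X\<close> and \<open>Y\<close> exactly twice, once in \<open>F\<close> and once outside;
    a chord of a shortest such cycle would shorten it.\<close>
  define good where "good p q \<longleftrightarrow> is_path X E p \<and> is_path Y E q \<and>
    {hd p, last q} \<in> E \<and> {hd p, last q} \<in> F \<and> {last p, hd q} \<in> E \<and> {last p, hd q} \<notin> F" for p q
  \<comment> \<open>Take \<open>p\<close> from \<open>x1\<close> to \<open>x2\<close> inside
    \<open>X\<close> and \<open>q\<close> from \<open>y2\<close> back to \<open>y1\<close> inside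
    \<open>Y\<close>.\<close>
  have start: "\<exists>p q. good p q"
    using conn e1 e2 unfolding connected_graph_def path_between_def good_def
    by metis
  have "\<exists>p q. good p q \<and> (\<forall>p' q'. good p' q' \<longrightarrow> length p + length q \<le> length p' + length q')"
  proof -
    obtain pq where "good (fst pq) (snd pq)" using start by auto
    from ex_has_least_nat[of "\<lambda>pq. good (fst pq) (snd pq)", OF this,
        of "\<lambda>pq. length (fst pq) + length (snd pq)"]
    show ?thesis by auto
  qed
  then obtain p q where g: "good p q"
    and "\<And>p' q'. good p' q' \<Longrightarrow> length p + length q \<le> length p' + length q'" by blast
  then have min: "\<not> good p' q'" if "length p' + length q' < length p + length q" for p' q'
    using that by (meson linorder_not_le)
  from g have p: "is_path X E p" and q: "is_path Y E q" and ne: "p \<noteq> []" "q \<noteq> []"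
    and sub: "set p \<subseteq> X" "set q \<subseteq> Y"
    and eF: "{hd p, last q} \<in> E" "{hd p, last q} \<in> F"
    and eN: "{last p, hd q} \<in> E" "{last p, hd q} \<notin> F"
    by (auto simp: good_def is_path_def)
  \<comment> \<open>Whether a pair is good depends on the paths only through their end vertices,
    which a shortcut keeps. So in a minimal pair each path is simple and induced.\<close>
  have no_shortcut_p: "\<not> (p ! a = p ! b \<or> {p ! a, p ! b} \<in> E \<and> Suc a < b)"
    if "a < b" "b < length p" for a b
    using path_shortcut[OF p that] g min unfolding good_def by (metis add_less_mono1)
  have no_shortcut_q: "\<not> (q ! a = q ! b \<or> {q ! a, q ! b} \<in> E \<and> Suc a < b)"
    if "a < b" "b < length q" for a b
    using path_shortcut[OF q that] g min unfolding good_def by (metis nat_add_left_cancel_less)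
  have "distinct p" "distinct q"
    unfolding distinct_conv_nth using no_shortcut_p no_shortcut_q by (metis linorder_neqE_nat)+
  then have dist: "distinct (p @ q)" using XY sub by auto
  have path: "is_path V E (p @ q)"
    using p q XY eN by (auto simp: is_path_def successively_append_iff)
  have cyc_edges: "cycle_edges (p @ q) =
      insert {hd p, last q} (path_edges p \<union> {{last p, hd q}} \<union> path_edges q)"
    using ne by (simp add: cycle_edges_def path_edges_append insert_commute)
  have short: "length p + length q \<le> 3"
  proof (rule ccontr)
    assume "\<not> ?thesis"
    then have "is_cycle V E (p @ q)" "4 \<le> length (p @ q)"
      using path dist eF ne by (auto simp: is_cycle_def insert_commute)
    then obtain e where e: "e \<in> E" "e \<subseteq> set p \<union> set q" "e \<notin> cycle_edges (p @ q)"
      using chordal by (auto simp: chordal_graph_def is_chord_def)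
    then obtain u v where uv: "e = {u, v}" "u \<noteq> v"
      using chordal by (auto simp: chordal_graph_def simple_graph_def)
    \<comment> \<open>Such a chord can replace the crossing edge of its own kind (in
      \<open>F\<close> or outside it). The part of the cycle containing the other crossing edge is
      again a good pair, so by minimality nothing was cut off and the chord is the crossing edge it
      replaced.\<close>
    have cross: False if "x \<in> set p" "y \<in> set q" "e = {x, y}" for x y
    proof -
      obtain a b where ab: "a < length p" "x = p ! a" "b < length q" "y = q ! b"
        using \<open>x \<in> set p\<close> \<open>y \<in> set q\<close> by (metis in_set_conv_nth)
      show False
      proof (cases "e \<in> F")
        case True
        have "good (drop a p) (take (Suc b) q)"
          using p q ab True e(1) that(3) eN ne unfolding good_def
          by (auto simp: is_path_take is_path_drop hd_drop_conv_nth last_take_Suc)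
        then have "\<not> length (drop a p) + length (take (Suc b) q) < length p + length q"
          using min by blast
        then have "a = 0" "b = length q - 1" using ab by auto
        then have "e = {hd p, last q}" using ab ne that by (simp add: hd_conv_nth last_conv_nth)
        then show False using e(3) cyc_edges by simp
      next
        case False
        have "good (take (Suc a) p) (drop b q)"
          using p q ab False e(1) that(3) eF ne unfolding good_def
          by (auto simp: is_path_take is_path_drop hd_drop_conv_nth last_take_Suc)
        then have "\<not> length (take (Suc a) p) + length (drop b q) < length p + length q"
          using min by blast
        then have "b = 0" "a = length p - 1" using ab by auto
        then have "e = {last p, hd q}" using ab ne that by (simp add: hd_conv_nth last_conv_nth)
        then show False using e(3) cyc_edges by simp
      qed
    qed
    consider "u \<in> set p" "v \<in> set p" | "u \<in> set q" "v \<in> set q"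
      | "u \<in> set p" "v \<in> set q" | "v \<in> set p" "u \<in> set q"
      using e uv by auto
    then show False
    proof cases
      case 1
      then obtain a b where "Suc a < b" "b < length p" "{u, v} = {p ! a, p ! b}"
        using nonadjacent_indices[of u p v] uv e cyc_edges by auto
      then show False using no_shortcut_p[of a b] e uv by auto
    next
      case 2
      then obtain a b where "Suc a < b" "b < length q" "{u, v} = {q ! a, q ! b}"
        using nonadjacent_indices[of u q v] uv e cyc_edges by auto
      then show False using no_shortcut_q[of a b] e uv by auto
    next
      case 3
      then show False using cross uv by blast
    next
      case 4
      then show False using cross uv by blast
    qed
  qed
  have "length p \<noteq> 0" "length q \<noteq> 0" using ne by auto
  \<comment> \<open>Two singletons would make both crossing edges equal, although only one of them
    is in \<open>F\<close>.\<close>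
  moreover have "\<not> (length p = 1 \<and> length q = 1)"
    using eF eN by (auto simp: length_Suc_conv)
  ultimately consider "length p = 1" "length q = 2" | "length p = 2" "length q = 1"
    using short by linarith
  then show thesis
  proof cases
    case 1
    \<comment> \<open>The names follow the orientation of the cycle: \<open>last q\<close> closes it
      through \<open>F\<close>, while \<open>hd q\<close> meets the edge outside
      \<open>F\<close>.\<close>
    then obtain x y y' where "p = [x]" "q = [y', y]"
      by (auto simp: length_Suc_conv numeral_2_eq_2)
    then show thesis using that[of x y y'] eF eN q sub by (auto simp: is_path_def insert_commute)
  next
    case 2
    then obtain x y y' where "q = [x]" "p = [y, y']"
      by (auto simp: length_Suc_conv numeral_2_eq_2)
    then show thesis using that[of x y y'] eF eN p sub by (auto simp: is_path_def insert_commute)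
  qed
qed

section \<open>Structure of separator paths\<close>

lemma path_edges_subpath:
  "path_edges (subpath r a b) = {{r ! k, r ! Suc k} | k. a \<le> k \<and> k < b}"
proof (intro equalityI subsetI)
  fix e assume "e \<in> path_edges (subpath r a b)"
  then obtain k where "Suc k < Suc b - a" "e = {r ! (a + k), r ! Suc (a + k)}"
    by (auto simp: path_edges_def subpath_def simp del: upt_Suc)
  then show "e \<in> {{r ! k, r ! Suc k} | k. a \<le> k \<and> k < b}"
    by (intro CollectI exI[of _ "a + k"]) auto
next
  fix e assume "e \<in> {{r ! k, r ! Suc k} | k. a \<le> k \<and> k < b}"
  then obtain k where k: "a \<le> k" "k < b" "e = {r ! k, r ! Suc k}" by blast
  then show "e \<in> path_edges (subpath r a b)"
    unfolding path_edges_def subpath_def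
    by (intro CollectI exI[of _ "k - a"]) (auto simp: Suc_diff_le simp del: upt_Suc)
qed

lemma is_path_subpath:
  assumes "is_path V E r" "a \<le> b" "b < length r"
  shows "is_path V E (subpath r a b)"
  using assms unfolding is_path_def subpath_def
  by (auto simp: successively_conv_nth simp del: upt_Suc)

text \<open>The length bound makes the subpath different from \<open>r\<close>, so minimality of
  \<open>r\<close> forbids it to separate.\<close>

lemma separator_path_proper_subpath:
  assumes "separator_path V E r" "a \<le> b" "b < length r" "b - a < length r - 1"
  shows "connected_graph V (E - {{r ! k, r ! Suc k} | k. a \<le> k \<and> k < b})"
proof -
  have "length (subpath r a b) = Suc b - a" by (simp add: subpath_def del: upt_Suc)
  then have "subpath r a b \<noteq> r" using assms by auto
  moreover have "contains_path r (subpath r a b)" using assms by (auto simp: contains_path_def)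
  ultimately have "\<not> separating_path V E (subpath r a b)"
    using assms by (auto simp: separator_path_def)
  moreover have "is_path V E (subpath r a b)"
    using assms by (intro is_path_subpath) (auto simp: separator_path_def separating_path_def)
  ultimately show ?thesis by (simp add: separating_path_def path_edges_subpath)
qed

text \<open>The two components are passed on as a Boolean \<open>side\<close>, so that alternation
  along \<open>r\<close> becomes a parity statement about indices.\<close>

lemma separator_path_alternates:
  assumes chordal: "chordal_graph V E" and conn: "connected_graph V E" and sep: "separator_path V E r"
  obtains side where
    "\<And>u v. (u, v) \<in> reach V (E - path_edges r) \<Longrightarrow> side u \<longleftrightarrow> side v"
    "\<And>k. Suc k < length r \<Longrightarrow> side (r ! Suc k) \<longleftrightarrow> \<not> side (r ! k)"
    "\<And>k. Suc (Suc k) < length r \<Longrightarrow> {r ! k, r ! Suc (Suc k)} \<in> E"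
proof -
  define D where "D = E - path_edges r"
  define side where "side v \<longleftrightarrow> (r ! 0, v) \<in> reach V D" for v
  have r: "is_path V E r" "distinct r" and ndc: "\<not> connected_graph V D"
    using sep by (auto simp: separator_path_def separating_path_def D_def)
  have "length r \<noteq> 0" using r by (auto simp: is_path_def)
  moreover have "length r \<noteq> 1"
  proof
    assume "length r = 1"
    then have "D = E" by (auto simp: D_def path_edges_def)
    then show False using ndc conn by simp
  qed
  \<comment> \<open>The edges of \<open>r\<close> are thus indexed from \<open>0\<close> to
    \<open>n\<close>, and the last one joins \<open>r ! n\<close> to
    \<open>r ! Suc n\<close>.\<close>
  ultimately obtain n where n: "length r = Suc (Suc n)"
    by (metis One_nat_def old.nat.exhaust)
  have rV: "r ! k \<in> V" if "k < length r" for k using r that by (auto simp: is_path_def)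
  have rE: "{r ! k, r ! Suc k} \<in> E" if "Suc k < length r" for k
    using r that by (auto simp: is_path_def successively_conv_nth)
  have r_eq: "r ! k = r ! l \<longleftrightarrow> k = l" if "k < length r" "l < length r" for k l
    using r(2) that by (simp add: nth_eq_iff_index_eq)
  \<comment> \<open>If the index range covers every edge of \<open>r\<close> except number
    \<open>l\<close>, then deleting the range instead of all of \<open>r\<close> restores at most
    that one edge.\<close>
  have D_subset: "E - {{r ! k, r ! Suc k} | k. a \<le> k \<and> k < b} \<subseteq> insert {r ! l, r ! Suc l} D"
    if l: "\<And>k. k < Suc n \<Longrightarrow> k \<noteq> l \<Longrightarrow> a \<le> k \<and> k < b" for a b l
  proof
    fix e assume e: "e \<in> E - {{r ! k, r ! Suc k} | k. a \<le> k \<and> k < b}"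
    show "e \<in> insert {r ! l, r ! Suc l} D"
    proof (cases "e \<in> D")
      case False
      then obtain k where k: "k < Suc n" "e = {r ! k, r ! Suc k}"
        using e n by (auto simp: D_def path_edges_def)
      then have "k = l" using e l by blast
      then show ?thesis using k by simp
    qed simp
  qed
  \<comment> \<open>The subpath omitting the first edge does not separate, so restoring this edge
    alone reconnects \<open>D\<close>; hence its ends represent the two components. The same holds
    for the last edge below.\<close>
  have first: "(r ! 0, v) \<in> reach V D \<longleftrightarrow> (r ! Suc 0, v) \<notin> reach V D" if "v \<in> V" for v
  proof (rule two_components[OF _ _ ndc _ _ that])
    show "connected_graph V (E - {{r ! k, r ! Suc k} | k. 1 \<le> k \<and> k < Suc n})"
      using n by (intro separator_path_proper_subpath[OF sep]) auto
    show "E - {{r ! k, r ! Suc k} | k. 1 \<le> k \<and> k < Suc n} \<subseteq> insert {r ! 0, r ! Suc 0} D"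
      by (rule D_subset) auto
  qed (use n rV in auto)
  have last: "(r ! n, v) \<in> reach V D \<longleftrightarrow> (r ! Suc n, v) \<notin> reach V D" if "v \<in> V" for v
  proof (rule two_components[OF _ _ ndc _ _ that])
    show "connected_graph V (E - {{r ! k, r ! Suc k} | k. 0 \<le> k \<and> k < n})"
      using n by (intro separator_path_proper_subpath[OF sep]) auto
    show "E - {{r ! k, r ! Suc k} | k. 0 \<le> k \<and> k < n} \<subseteq> insert {r ! n, r ! Suc n} D"
      by (rule D_subset) auto
  qed (use n rV in auto)
  have side: "side u \<longleftrightarrow> side v" if "(u, v) \<in> reach V D" for u v
    unfolding side_def using that by (blast intro: reach_trans reach_sym)
  define A where "A = {v. (r ! 0, v) \<in> reach V D}"
  define B where "B = {v. (r ! Suc 0, v) \<in> reach V D}"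
  have AV: "A \<subseteq> V" and BV: "B \<subseteq> V" using rV n by (auto simp: A_def B_def intro: reach_closed)
  have sideA: "v \<in> A \<longleftrightarrow> side v" for v by (simp add: A_def side_def)
  have sideB: "v \<in> B \<longleftrightarrow> \<not> side v" if "v \<in> V" for v using first that by (simp add: B_def side_def)
  have AB: "A \<inter> B = {}" using BV sideA sideB by blast
  have connA: "connected_graph A E" and connB: "connected_graph B E"
    by (auto intro!: connected_graph_component[of D] simp: D_def A_def B_def)
  have s0: "side (r ! 0)" "\<not> side (r ! Suc 0)"
    using first[of "r ! 0"] rV n by (auto simp: side_def dest: reach_sym)
  have sn: "side (r ! Suc n) \<longleftrightarrow> \<not> side (r ! n)"
    using last[of "r ! 0"] rV n unfolding side_def by (auto dest: reach_sym)
  have D_side: "side u \<longleftrightarrow> side v" if "u \<in> V" "v \<in> V" "{u, v} \<in> D" for u v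
    using that by (intro side reach_edge)
  have cross_edge: "e \<in> path_edges r" if "e = {u, v}" "e \<in> E" "u \<in> V" "v \<in> V" "side u \<noteq> side v" for e u v
    using D_side[of u v] that by (auto simp: D_def)
  have step: "{r ! k, r ! Suc (Suc k)} \<in> E \<and> side (r ! Suc k) \<noteq> side (r ! k)
      \<and> side (r ! Suc (Suc k)) = side (r ! k)"
    if k: "Suc (Suc k) < length r" for k
  proof -
    \<comment> \<open>The first and last edges of \<open>r\<close> are the ones already known to
      cross. Since \<open>k < n\<close>, this \<open>F\<close> contains the first but not the last,
      as \<open>crossing_triangle\<close> requires.\<close>
    define F where "F = {{r ! m, r ! Suc m} | m. m \<le> k}"
    have in_F: "{r ! l, r ! Suc l} \<in> F \<longleftrightarrow> l \<le> k" if "Suc l < length r" for l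
      using that k by (auto simp: F_def doubleton_eq_iff r_eq)
    \<comment> \<open>Which end of the last edge lies in \<open>A\<close> is not known yet, so its
      ends are named by component.\<close>
    obtain xn yn where xn: "xn \<in> A" "yn \<in> B" "{xn, yn} = {r ! n, r ! Suc n}"
    proof (cases "side (r ! n)")
      case True
      then show ?thesis using that[of "r ! n" "r ! Suc n"] sn n rV sideA sideB by auto
    next
      case False
      then show ?thesis
        using that[of "r ! Suc n" "r ! n"] sn n rV sideA sideB by (auto simp: insert_commute)
    qed
    have "{xn, yn} \<in> E" "{xn, yn} \<notin> F"
      using xn rE[of n] in_F[of n] n k by simp_all
    moreover have "{r ! 0, r ! Suc 0} \<in> F" "{r ! 0, r ! Suc 0} \<in> E"
      using in_F[of 0] rE[of 0] n by simp_all
    moreover have "r ! 0 \<in> A" "r ! Suc 0 \<in> B"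
      using s0 sideA sideB rV n by auto
    ultimately obtain x y y' where t: "{x, y} \<in> E" "{x, y} \<in> F" "{x, y'} \<in> E" "{x, y'} \<notin> F" "{y, y'} \<in> E"
      and xy: "x \<in> A \<and> y \<in> B \<and> y' \<in> B \<or> x \<in> B \<and> y \<in> A \<and> y' \<in> A"
      using crossing_triangle[OF chordal AV BV AB connA connB _ _ _ _ xn(1,2), of "r ! 0" "r ! Suc 0" F]
      by metis
    have V: "x \<in> V" "y \<in> V" "y' \<in> V" using xy AV BV by auto
    have sd: "side x \<noteq> side y" "side y' = side y" using xy V sideA sideB by auto
    obtain m where m: "{x, y} = {r ! m, r ! Suc m}" "m \<le> k" using t(2) by (auto simp: F_def)
    have "{x, y'} \<in> path_edges r" using cross_edge t(3) V sd by metis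
    then obtain l where l: "{x, y'} = {r ! l, r ! Suc l}" "Suc l < length r"
      by (auto simp: path_edges_def)
    then have "k < l" using in_F[of l] t(4) by simp
    \<comment> \<open>The apex \<open>x\<close> is an end of edge \<open>m\<close> and of edge
      \<open>l\<close> of \<open>r\<close>, with \<open>m \<le> k < l\<close>. Vertices of
      \<open>r\<close> are distinct, so the two edges are consecutive, which forces
      \<open>m = k\<close> and \<open>l = Suc k\<close>.\<close>
    have "x \<in> {r ! m, r ! Suc m}" "x \<in> {r ! l, r ! Suc l}" using m(1) l(1) by blast+
    then have "Suc m = l" "x = r ! l" using \<open>k < l\<close> m(2) l(2) by (auto simp: r_eq)
    then have "m = k" "l = Suc k" using \<open>k < l\<close> m(2) by auto
    then have "x = r ! Suc k" "y = r ! k" "y' = r ! Suc (Suc k)"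
      using \<open>x = r ! l\<close> m(1) l(1) by (auto simp: doubleton_eq_iff)
    then show ?thesis using t(5) sd by simp
  qed
  show thesis
  proof (rule that[of side])
    show "side u \<longleftrightarrow> side v" if "(u, v) \<in> reach V (E - path_edges r)" for u v
      using side that by (simp add: D_def)
    show "side (r ! Suc k) \<longleftrightarrow> \<not> side (r ! k)" if "Suc k < length r" for k
    proof (cases k)
      case 0
      then show ?thesis using s0 by simp
    next
      case (Suc l)
      then show ?thesis using step[of l] that by auto
    qed
    show "{r ! k, r ! Suc (Suc k)} \<in> E" if "Suc (Suc k) < length r" for k
      using step[OF that] by blast
  qed
qed

section \<open>Strong connection along a separator path\<close>

theorem theorem9:
  fixes V :: "'a set" and E :: "'a set set" and r :: "'a list"
  assumes "chordal_graph V E"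
    and "connected_graph V E"
    and "separator_path V E r"
  shows "\<forall>i j. i < j \<and> j < length r \<longrightarrow>
    (strongly_connected V E r (r ! i) (r ! j) \<longleftrightarrow> j - i = 2)"
proof (intro allI impI, elim conjE)
  fix i j
  assume ij: "i < j" "j < length r"
  obtain side where side: "\<And>u v. (u, v) \<in> reach V (E - path_edges r) \<Longrightarrow> side u \<longleftrightarrow> side v"
    and alt: "\<And>k. Suc k < length r \<Longrightarrow> side (r ! Suc k) \<longleftrightarrow> \<not> side (r ! k)"
    and chord: "\<And>k. Suc (Suc k) < length r \<Longrightarrow> {r ! k, r ! Suc (Suc k)} \<in> E"
    using separator_path_alternates[OF assms] by metis
  have r: "is_path V E r" "distinct r"
    using assms(3) by (auto simp: separator_path_def separating_path_def)
  have rV: "r ! k \<in> V" if "k < length r" for k using r that by (auto simp: is_path_def)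
  have rE: "{r ! k, r ! Suc k} \<in> E" if "Suc k < length r" for k
    using r that by (auto simp: is_path_def successively_conv_nth)
  have r_eq: "r ! k = r ! l \<longleftrightarrow> k = l" if "k < length r" "l < length r" for k l
    using r(2) that by (simp add: nth_eq_iff_index_eq)
  have parity: "side (r ! (i + d)) \<longleftrightarrow> (side (r ! i) \<longleftrightarrow> even d)" if "i + d < length r" for d
    using that by (induction d) (auto simp: alt)
  show "strongly_connected V E r (r ! i) (r ! j) \<longleftrightarrow> j - i = 2"
  proof
    assume "j - i = 2"
    then have j: "j = Suc (Suc i)" by simp
    have "{r ! i, r ! j} \<notin> path_edges r"
      using ij j by (auto simp: path_edges_def doubleton_eq_iff r_eq)
    then show "strongly_connected V E r (r ! i) (r ! j)"
      using chord[of i] rV ij j unfolding strongly_connected_def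
      by (intro exI[of _ "[r ! i, r ! j]"])
        (auto simp: path_between_def is_path_def path_edges_def)
  next
    assume "strongly_connected V E r (r ! i) (r ! j)"
    then obtain p where p: "is_path V E p" "hd p = r ! i" "last p = r ! j"
      and disj: "path_edges p \<inter> path_edges r = {}" and meet: "set p \<inter> set r \<subseteq> {r ! i, r ! j}"
      by (auto simp: strongly_connected_def path_between_def)
    \<comment> \<open>Since \<open>p\<close> avoids the edges of \<open>r\<close>, it stays in one
      component; comparing the sides of its ends then gives the parity of
      \<open>j - i\<close>.\<close>
    have "is_path V (E - path_edges r) p"
      using p(1) disj by (auto simp: is_path_def successively_conv_nth path_edges_def)
    then have p_side: "side x \<longleftrightarrow> side (r ! i)" if "x \<in> set p" for x
      using side path_reach that p(2) by metis
    have ends: "r ! i \<in> set p" "r ! j \<in> set p"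
      using p by (auto simp: is_path_def simp flip: p(2,3))
    have ev: "even (j - i)" using parity[of "j - i"] p_side[OF ends(2)] ij by auto
    show "j - i = 2"
    proof (rule ccontr)
      assume "j - i \<noteq> 2"
      then have "4 \<le> j - i" using ev ij by presburger
      define Y where "Y = {r ! (i + d) | d. odd d \<and> i + d < j}"
      have Y_I: "r ! (i + d) \<in> Y" if "odd d" "i + d < j" for d
        using that by (auto simp: Y_def)
      have YV: "Y \<subseteq> V" using rV ij by (auto simp: Y_def)
      \<comment> \<open>Members of \<open>Y\<close> have odd offset from \<open>i\<close>, hence lie
        on the side opposite to all of \<open>p\<close>.\<close>
      have disjoint: "set p \<inter> Y = {}"
        using p_side parity ij by (force simp: Y_def)
      have "(r ! Suc i, r ! (i + Suc (2 * m))) \<in> reach Y E" if "i + Suc (2 * m) < j" for m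
        using that
      proof (induction m)
        case 0
        show ?case by simp
      next
        case (Suc m)
        have "(r ! (i + Suc (2 * m)), r ! (i + Suc (2 * Suc m))) \<in> reach Y E"
        proof (rule reach_edge)
          show "r ! (i + Suc (2 * m)) \<in> Y" "r ! (i + Suc (2 * Suc m)) \<in> Y"
            using Suc.prems by (auto intro!: Y_I simp del: add_Suc_right)
          show "{r ! (i + Suc (2 * m)), r ! (i + Suc (2 * Suc m))} \<in> E"
            using chord[of "i + Suc (2 * m)"] Suc.prems ij by simp
        qed
        with Suc show ?case by (auto intro: reach_trans)
      qed
      then have connY: "connected_graph Y E"
        by (intro connected_graph_root[of _ "r ! Suc i"]) (auto simp: Y_def elim!: oddE)
      \<comment> \<open>An edge from \<open>p\<close> to \<open>Y\<close> changes sides and so lies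
        on \<open>r\<close>. Its end on \<open>p\<close> must be \<open>r ! i\<close> or
        \<open>r ! j\<close>, and the only neighbours of these along \<open>r\<close> with index
        strictly between \<open>i\<close> and \<open>j\<close> are \<open>r ! Suc i\<close> and
        \<open>r ! (j - 1)\<close>.\<close>
      have cross: "x = r ! i \<and> y = r ! Suc i \<or> x = r ! j \<and> y = r ! (j - 1)"
        if "x \<in> set p" "y \<in> Y" "{x, y} \<in> E" for x y
      proof -
        obtain d where d: "y = r ! (i + d)" "odd d" "i + d < j" using \<open>y \<in> Y\<close> by (auto simp: Y_def)
        have "side x \<noteq> side y" using p_side[OF that(1)] parity[of d] d ij by auto
        then have "{x, y} \<in> path_edges r"
          using side[OF reach_edge[of x V y]] that p(1) YV by (auto simp: is_path_def)
        then obtain k where k: "{x, y} = {r ! k, r ! Suc k}" "Suc k < length r"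
          by (auto simp: path_edges_def)
        then have "x \<in> set r" by (auto simp: doubleton_eq_iff)
        then have "x = r ! i \<or> x = r ! j" using meet that by blast
        moreover have "r ! i \<noteq> r ! j" using ij by (simp add: r_eq)
        ultimately show ?thesis using k d ij by (auto simp: doubleton_eq_iff r_eq)
      qed
      have i1: "r ! Suc i \<in> Y" "{r ! i, r ! Suc i} \<in> E"
        using ij \<open>4 \<le> j - i\<close> rE[of i] by (auto simp: Y_def intro!: exI[of _ 1])
      have j1: "r ! (j - 1) \<in> Y" "{r ! j, r ! (j - 1)} \<in> E"
        using ij ev \<open>4 \<le> j - i\<close> rE[of "j - 1"]
        \<comment> \<open>The offset of \<open>r ! (j - 1)\<close> is \<open>j - i - 1\<close>, odd
          because \<open>j - i\<close> is even.\<close>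
        by (auto simp: Y_def insert_commute intro!: exI[of _ "j - i - 1"])
      have ne: "r ! i \<noteq> r ! j" "r ! Suc i \<noteq> r ! (j - 1)" "{r ! j, r ! (j - 1)} \<noteq> {r ! i, r ! Suc i}"
        using ij \<open>4 \<le> j - i\<close> by (auto simp: r_eq doubleton_eq_iff)
      have pV: "set p \<subseteq> V" using p(1) by (simp add: is_path_def)
      define F where "F = {{r ! i, r ! Suc i}}"
      have F: "{r ! i, r ! Suc i} \<in> F" "{r ! j, r ! (j - 1)} \<notin> F"
        using ne(3) by (simp_all add: F_def)
      obtain x y y' where t: "{x, y} \<in> E" "{x, y} \<in> F" "{x, y'} \<in> E" "{x, y'} \<notin> F"
        and xy: "x \<in> set p \<and> y \<in> Y \<and> y' \<in> Y \<or> x \<in> Y \<and> y \<in> set p \<and> y' \<in> set p"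
        using crossing_triangle[OF assms(1) pV YV disjoint connected_graph_path[OF p(1)] connY
            ends(1) i1 F(1) ends(2) j1 F(2)] by metis
      \<comment> \<open>By \<open>cross\<close>, the triangle edge in \<open>F\<close> is the first
        edge of \<open>r\<close> after \<open>r ! i\<close>, and the one outside \<open>F\<close> is
        the last edge before \<open>r ! j\<close>. They would share \<open>x\<close>, but their four
        ends are distinct.\<close>
      from xy show False
      proof
        assume *: "x \<in> set p \<and> y \<in> Y \<and> y' \<in> Y"
        show False using cross[of x y] cross[of x y'] * t F ne by auto
      next
        assume *: "x \<in> Y \<and> y \<in> set p \<and> y' \<in> set p"
        show False using cross[of y x] cross[of y' x] * t F ne by (auto simp: insert_commute)
      qed
    qed
  qed
qed

end
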